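(* Let $s,t\ge 1$ and $r\ge 3$ be integers with $r<s+t$, and let $G=K_s\,\dot\cup\,K_t$ be the disjoint union of complete graphs of orders $s$ and $t$. Then $G$ is $r$-neutral if $r$ is even, $G$ is $r$-void if $r\equiv 1\pmod 4$, and $G$ is $r$-complete if $r\equiv 3\pmod 4$.
   Context: For a graph $G$ of order $n$ and an integer $r$ with $2<r\le n$: $G$ is called $r$-complete if every subgraph of $G$ induced by $r$ vertices has an odd number of edges; $r$-void if every subgraph induced by $r$ vertices has an even number of edges; and $r$-neutral if it is neither $r$-complete nor $r$-void. *)

theory Defs
  imports "HOL-Library.Ramsey" "HOL-Number_Theory.Cong"
begin

text \<open>Edges are two-element vertex sets; \<open>[V]\<^bsup>2\<^esup>\<close> is the library's \<^const>\<open>nsets\<close>.\<close>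

record 'a ugraph =
  verts :: "'a set"
  edges :: "'a set set"

definition simple_graph :: "'a ugraph \<Rightarrow> bool" where
  "simple_graph G \<longleftrightarrow> finite (verts G) \<and> edges G \<subseteq> [verts G]\<^bsup>2\<^esup>"

definition graph_order :: "'a ugraph \<Rightarrow> nat" where
  "graph_order G = card (verts G)"

definition induced_subgraph :: "'a ugraph \<Rightarrow> 'a set \<Rightarrow> 'a ugraph" where
  "induced_subgraph G S = \<lparr>verts = S, edges = {e \<in> edges G. e \<subseteq> S}\<rparr>"

definition num_edges :: "'a ugraph \<Rightarrow> nat" where
  "num_edges G = card (edges G)"

text \<open>\<open>is_complete_graph n G\<close>: \<open>G\<close> is a copy of \<open>K\<^sub>n\<close>, on an arbitrary vertex set of size \<open>n\<close>.\<close>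

definition is_complete_graph :: "nat \<Rightarrow> 'a ugraph \<Rightarrow> bool" where
  "is_complete_graph n G \<longleftrightarrow>
     simple_graph G \<and> graph_order G = n \<and> edges G = [verts G]\<^bsup>2\<^esup>"

definition is_disjoint_union :: "'a ugraph \<Rightarrow> 'a ugraph \<Rightarrow> 'a ugraph \<Rightarrow> bool" where
  "is_disjoint_union G H K \<longleftrightarrow> verts H \<inter> verts K = {} \<and>
     verts G = verts H \<union> verts K \<and> edges G = edges H \<union> edges K"

text \<open>The three parity notions are only meaningful for \<open>2 < r \<le> n\<close> with \<open>n\<close> the order of the
  graph; each of them includes this side condition.\<close>

definition r_complete :: "nat \<Rightarrow> 'a ugraph \<Rightarrow> bool" where
  "r_complete r G \<longleftrightarrow> 2 < r \<and> r \<le> graph_order G \<and>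
     (\<forall>S\<in>[verts G]\<^bsup>r\<^esup>. odd (num_edges (induced_subgraph G S)))"

definition r_void :: "nat \<Rightarrow> 'a ugraph \<Rightarrow> bool" where
  "r_void r G \<longleftrightarrow> 2 < r \<and> r \<le> graph_order G \<and>
     (\<forall>S\<in>[verts G]\<^bsup>r\<^esup>. even (num_edges (induced_subgraph G S)))"

definition r_neutral :: "nat \<Rightarrow> 'a ugraph \<Rightarrow> bool" where
  "r_neutral r G \<longleftrightarrow> 2 < r \<and> r \<le> graph_order G \<and> \<not> r_complete r G \<and> \<not> r_void r G"

lemma simple_graph_disjoint_union:
  assumes "simple_graph H" "simple_graph K" "is_disjoint_union G H K"
  shows "simple_graph G"
  using assms unfolding simple_graph_def is_disjoint_union_def nsets_def by auto

lemma simple_graph_induced_subgraph: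
  assumes "simple_graph G" "S \<subseteq> verts G"
  shows "simple_graph (induced_subgraph G S)"
  using assms unfolding simple_graph_def induced_subgraph_def nsets_def
  by (auto intro: finite_subset)

end

theory Submission
  imports Defs
begin

text \<open>An \<open>r\<close>-set meeting the two cliques in \<open>a\<close> and \<open>b\<close> vertices induces \<open>(r choose 2) - a b\<close>
  edges. For odd \<open>r = a + b\<close> the product \<open>a b\<close> is even, so the parity is that of \<open>r choose 2\<close>,
  which depends only on \<open>r\<close> modulo 4. For even \<open>r\<close>, since \<open>r < s + t\<close>, some \<open>r + 1 = a + b\<close>
  vertices meet the cliques in \<open>a, b \<ge> 1\<close> vertices; deleting one of them from the
  first or from the second clique turns \<open>a b\<close> into \<open>(a - 1) b\<close> or \<open>a (b - 1)\<close>, and these differ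
  by the odd number \<open>a - b\<close>.\<close>

lemma add_choose_two: "(m + n) choose 2 = (m choose 2) + (n choose 2) + m * n"
  by (induction m) (auto simp: numeral_2_eq_2)

lemma even_choose_two_iff: "even (n choose 2) \<longleftrightarrow> n mod 4 \<in> {0, 1}"
proof (induction n)
  case 0
  show ?case
    by (simp add: numeral_2_eq_2)
next
  case (Suc n)
  have "Suc n choose 2 = n + (n choose 2)"
    by (simp add: numeral_2_eq_2)
  then have "even (Suc n choose 2) \<longleftrightarrow> (even n \<longleftrightarrow> even (n choose 2))"
    by simp
  also have "\<dots> \<longleftrightarrow> (even n \<longleftrightarrow> n mod 4 \<in> {0, 1})"
    using Suc.IH by simp
  also have "\<dots> \<longleftrightarrow> Suc n mod 4 \<in> {0, 1}"
  proof -
    have "n mod 4 \<in> {0, 1, 2, 3}"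
      by auto
    then show ?thesis
      by (auto simp: even_even_mod_4_iff[of n] mod_Suc)
  qed
  finally show ?case .
qed

lemma finite_verts: "simple_graph G \<Longrightarrow> finite (verts G)"
  by (simp add: simple_graph_def)

lemma finite_edges: "simple_graph G \<Longrightarrow> finite (edges G)"
  by (auto simp: simple_graph_def intro: finite_subset finite_imp_finite_nsets)

lemma num_edges_complete_graph:
  assumes "is_complete_graph n G"
  shows "num_edges G = n choose 2"
  using assms by (simp add: is_complete_graph_def graph_order_def num_edges_def)

lemma is_complete_graph_induced_subgraph:
  assumes "is_complete_graph n G" and "S \<subseteq> verts G"
  shows "is_complete_graph (card S) (induced_subgraph G S)"
  using assms simple_graph_induced_subgraph[of G S]
  by (auto simp: is_complete_graph_def graph_order_def induced_subgraph_def nsets_def)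

lemma graph_order_disjoint_union:
  assumes "simple_graph H" and "simple_graph K" and "is_disjoint_union G H K"
  shows "graph_order G = graph_order H + graph_order K"
  using assms by (simp add: simple_graph_def is_disjoint_union_def graph_order_def card_Un_disjoint)

lemma num_edges_disjoint_union:
  assumes "simple_graph H" and "simple_graph K" and "is_disjoint_union G H K"
  shows "num_edges G = num_edges H + num_edges K"
proof -
  have "edges H \<inter> edges K \<subseteq> [verts H \<inter> verts K]\<^bsup>2\<^esup>"
    using assms(1,2) by (auto simp: simple_graph_def nsets_def)
  then have "edges H \<inter> edges K = {}"
    using assms(3) by (simp add: is_disjoint_union_def nsets_empty_iff)
  then show ?thesis
    using assms by (simp add: num_edges_def is_disjoint_union_def finite_edges card_Un_disjoint)
qed

lemma is_disjoint_union_induced_subgraph: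
  assumes "simple_graph H" and "simple_graph K" and "is_disjoint_union G H K"
    and "S \<subseteq> verts G"
  shows "is_disjoint_union (induced_subgraph G S)
    (induced_subgraph H (S \<inter> verts H)) (induced_subgraph K (S \<inter> verts K))"
  using assms by (auto simp: is_disjoint_union_def simple_graph_def induced_subgraph_def nsets_def)

lemma r_neutralI:
  assumes "2 < r" and "r \<le> graph_order G" and "S \<in> [verts G]\<^bsup>r\<^esup>" and "T \<in> [verts G]\<^bsup>r\<^esup>"
    and "odd (num_edges (induced_subgraph G S)) \<longleftrightarrow> even (num_edges (induced_subgraph G T))"
  shows "r_neutral r G"
  using assms unfolding r_neutral_def r_complete_def r_void_def by blast

locale two_cliques =
  fixes s t :: nat and Ks Kt G :: "'a ugraph"
  assumes complete_Ks: "is_complete_graph s Ks"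
    and complete_Kt: "is_complete_graph t Kt"
    and disjoint_union: "is_disjoint_union G Ks Kt"
begin

lemma simple_Ks: "simple_graph Ks" and simple_Kt: "simple_graph Kt"
  using complete_Ks complete_Kt by (simp_all add: is_complete_graph_def)

lemma simple_G: "simple_graph G"
  using simple_graph_disjoint_union simple_Ks simple_Kt disjoint_union .

lemma graph_order_eq: "graph_order G = s + t"
  using graph_order_disjoint_union[OF simple_Ks simple_Kt disjoint_union] complete_Ks complete_Kt
  by (simp add: is_complete_graph_def)

lemma card_Int_cliques:
  assumes "S \<subseteq> verts G"
  shows "card (S \<inter> verts Ks) + card (S \<inter> verts Kt) = card S"
proof -
  have "card (S \<inter> verts Ks) + card (S \<inter> verts Kt) = card ((S \<inter> verts Ks) \<union> (S \<inter> verts Kt))"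
    using disjoint_union finite_verts[OF simple_Ks] finite_verts[OF simple_Kt]
    by (intro card_Un_disjoint[symmetric]) (auto simp: is_disjoint_union_def)
  also have "(S \<inter> verts Ks) \<union> (S \<inter> verts Kt) = S"
    using assms disjoint_union by (auto simp: is_disjoint_union_def)
  finally show ?thesis .
qed

lemma num_edges_induced_subgraph:
  assumes "S \<subseteq> verts G"
  shows "num_edges (induced_subgraph G S) + card (S \<inter> verts Ks) * card (S \<inter> verts Kt)
    = card S choose 2"
proof -
  let ?Hs = "induced_subgraph Ks (S \<inter> verts Ks)" and ?Ht = "induced_subgraph Kt (S \<inter> verts Kt)"
  have complete: "is_complete_graph (card (S \<inter> verts Ks)) ?Hs"
    "is_complete_graph (card (S \<inter> verts Kt)) ?Ht"
    using is_complete_graph_induced_subgraph complete_Ks complete_Kt by blast+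
  have "num_edges (induced_subgraph G S) = num_edges ?Hs + num_edges ?Ht"
  proof (rule num_edges_disjoint_union)
    show "simple_graph ?Hs" "simple_graph ?Ht"
      using complete by (simp_all add: is_complete_graph_def)
    show "is_disjoint_union (induced_subgraph G S) ?Hs ?Ht"
      using is_disjoint_union_induced_subgraph[OF simple_Ks simple_Kt disjoint_union assms] .
  qed
  also have "\<dots> = (card (S \<inter> verts Ks) choose 2) + (card (S \<inter> verts Kt) choose 2)"
    using complete by (simp add: num_edges_complete_graph)
  finally show ?thesis
    by (simp add: add_choose_two flip: card_Int_cliques[OF assms])
qed

lemma even_num_edges_induced_subgraph_iff:
  assumes "odd r" and "S \<in> [verts G]\<^bsup>r\<^esup>"
  shows "even (num_edges (induced_subgraph G S)) \<longleftrightarrow> r mod 4 = 1"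
proof -
  have S: "S \<subseteq> verts G" "card S = r"
    using assms(2) by (auto simp: nsets_def)
  have "even (card (S \<inter> verts Ks) * card (S \<inter> verts Kt))"
    using card_Int_cliques[OF S(1)] S(2) \<open>odd r\<close> by (metis even_add even_mult_iff)
  then have "even (num_edges (induced_subgraph G S)) \<longleftrightarrow> even (r choose 2)"
    using num_edges_induced_subgraph[OF S(1)] S(2) by (metis even_add)
  also have "\<dots> \<longleftrightarrow> r mod 4 = 1"
    unfolding even_choose_two_iff insert_iff empty_iff using \<open>odd r\<close> by presburger
  finally show ?thesis .
qed

lemma r_void_if_cong_1:
  assumes "2 < r" and "r \<le> s + t" and "[r = 1] (mod 4)"
  shows "r_void r G"
proof -
  have "r mod 4 = 1"
    using assms(3) by (simp add: cong_def)
  moreover from this have "odd r"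
    by presburger
  ultimately show ?thesis
    using assms(1,2) by (simp add: r_void_def graph_order_eq even_num_edges_induced_subgraph_iff)
qed

lemma r_complete_if_cong_3:
  assumes "r \<le> s + t" and "[r = 3] (mod 4)"
  shows "r_complete r G"
proof -
  have "r mod 4 = 3"
    using assms(2) by (simp add: cong_def)
  moreover from this have "odd r" "2 < r"
    by presburger+
  ultimately show ?thesis
    using assms(1) by (simp add: r_complete_def graph_order_eq even_num_edges_induced_subgraph_iff)
qed

lemma odd_num_edges_remove_vertex_iff:
  assumes "U \<subseteq> verts G" and "odd (card U)" and "u \<in> U \<inter> verts Ks" and "v \<in> U \<inter> verts Kt"
  shows "odd (num_edges (induced_subgraph G (U - {u})))
    \<longleftrightarrow> even (num_edges (induced_subgraph G (U - {v})))"
proof -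
  define a where "a = card (U \<inter> verts Ks - {u})"
  define b where "b = card (U \<inter> verts Kt - {v})"
  have "finite U"
    using assms(1) finite_verts[OF simple_G] finite_subset by blast
  then have card_U: "card (U \<inter> verts Ks) = Suc a" "card (U \<inter> verts Kt) = Suc b"
    unfolding a_def b_def using assms(3,4) by (blast intro: card.remove)+
  have "u \<notin> verts Kt" "v \<notin> verts Ks"
    using assms(3,4) disjoint_union by (auto simp: is_disjoint_union_def)
  then have Int_remove:
    "(U - {u}) \<inter> verts Ks = U \<inter> verts Ks - {u}" "(U - {u}) \<inter> verts Kt = U \<inter> verts Kt"
    "(U - {v}) \<inter> verts Ks = U \<inter> verts Ks" "(U - {v}) \<inter> verts Kt = U \<inter> verts Kt - {v}"
    by auto
  have card_remove: "card (U - {u}) = card U - 1" "card (U - {v}) = card U - 1"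
    using assms(3,4) by simp_all
  have edges: "num_edges (induced_subgraph G (U - {u})) + a * Suc b = (card U - 1) choose 2"
    "num_edges (induced_subgraph G (U - {v})) + Suc a * b = (card U - 1) choose 2"
    using num_edges_induced_subgraph[of "U - {u}"] num_edges_induced_subgraph[of "U - {v}"] assms(1)
    unfolding Int_remove card_remove card_U a_def b_def by blast+
  have "odd a \<longleftrightarrow> even b"
    using card_Int_cliques[OF assms(1)] assms(2) unfolding card_U by presburger
  then have "odd (a * Suc b) \<longleftrightarrow> even (Suc a * b)"
    by auto
  then show ?thesis
    using edges by (metis even_add)
qed

lemma r_neutral_if_even:
  assumes "s \<ge> 1" and "t \<ge> 1" and "2 < r" and "r < s + t" and "even r"
  shows "r_neutral r G"
proof -
  have "verts Ks \<noteq> {}" "verts Kt \<noteq> {}"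
    using assms(1,2) complete_Ks complete_Kt by (auto simp: is_complete_graph_def graph_order_def)
  then obtain u v where uv: "u \<in> verts Ks" "v \<in> verts Kt"
    by blast
  have "{u, v} \<subseteq> verts G"
    using uv disjoint_union by (auto simp: is_disjoint_union_def)
  moreover have "card {u, v} \<le> Suc r" "Suc r \<le> card (verts G)"
    using assms(3,4) graph_order_eq by (simp_all add: graph_order_def card_insert_if)
  ultimately obtain U where U: "{u, v} \<subseteq> U" "U \<subseteq> verts G" "card U = Suc r"
    using exists_subset_between[of "{u, v}" "Suc r" "verts G"] finite_verts[OF simple_G] by auto
  have "finite U"
    using U(2) finite_verts[OF simple_G] finite_subset by blast
  show ?thesis
  proof (rule r_neutralI)
    show "2 < r" "r \<le> graph_order G"
      using assms(3,4) by (simp_all add: graph_order_eq)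
    show "U - {u} \<in> [verts G]\<^bsup>r\<^esup>" "U - {v} \<in> [verts G]\<^bsup>r\<^esup>"
      using U \<open>finite U\<close> by (auto simp: nsets_def)
    show "odd (num_edges (induced_subgraph G (U - {u})))
      \<longleftrightarrow> even (num_edges (induced_subgraph G (U - {v})))"
      using odd_num_edges_remove_vertex_iff U uv \<open>even r\<close> by simp
  qed
qed

end

theorem theorem10:
  fixes s t r :: nat and Ks Kt G :: "'a ugraph"
  assumes "s \<ge> 1" and "t \<ge> 1" and "r \<ge> 3" and "r < s + t"
    and "is_complete_graph s Ks" and "is_complete_graph t Kt"
    and "is_disjoint_union G Ks Kt"
  shows "(even r \<longrightarrow> r_neutral r G) \<and>
         ([r = 1] (mod 4) \<longrightarrow> r_void r G) \<and>
         ([r = 3] (mod 4) \<longrightarrow> r_complete r G)"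
proof -
  interpret two_cliques s t Ks Kt G
    using assms(5-7) by unfold_locales
  show ?thesis
    using assms(1-4) r_neutral_if_even r_void_if_cong_1 r_complete_if_cong_3 by simp
qed

end
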